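(* Let $(X,d_X,\leq_{P_1})$ and $(Y,d_Y,\leq_{P_2})$ be two partially ordered complete metric spaces and let $F:X\times Y\rightarrow X$, $G:Y\times X\rightarrow Y$ be two mappings (not assumed continuous) having the mixed monotone property. Assume that $X$ and $Y$ have the following properties: (i) if a non-decreasing sequence $\{x_j\}$ in $X$ converges to $x\in X$, then $x_j\leq_{P_1} x$ for all $j$; (ii) if a non-increasing sequence $\{y_j\}$ in $Y$ converges to $y\in Y$, then $y\leq_{P_2} y_j$ for all $j$. Also assume that there exist $k,l,m,n\in [0,1)$ with $k+l<1$ and $m+n<1$ such that $$d_X(F(x,y),F(u,v))\leq k\, d_X(x,u)+l\, d_Y(y,v)\quad \text{for all } x,u\in X,\ y,v\in Y \text{ with } x\geq_{P_1}u,\ y\leq_{P_2}v,$$ $$d_Y(G(y,x),G(v,u))\leq m\, d_Y(y,v)+n\, d_X(x,u)\quad \text{for all } x,u\in X,\ y,v\in Y \text{ with } x\leq_{P_1}u,\ y\geq_{P_2}v.$$ If there exist $x_0\in X$, $y_0\in Y$ such that $x_0\leq_{P_1} F(x_0, y_0)$ and $y_0\geq_{P_2} G(y_0, x_0)$, then there exists $(x,y)\in X\times Y$ such that $x=F(x,y)$ and $y=G(y,x)$.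
   Context: A partially ordered complete metric space $(X,d_X,\leq_{P_1})$ is a set $X$ with a metric $d_X$ for which it is complete and a partial order $\leq_{P_1}$ (no compatibility between them is assumed beyond what is stated). The maps $F:X\times Y\to X$ and $G:Y\times X\to Y$ have the mixed monotone property if for all $x\in X$, $y\in Y$: for all $x_1,x_2\in X$, $x_1\leq_{P_1} x_2$ implies $F(x_1,y)\leq_{P_1} F(x_2,y)$ and $G(y,x_1)\geq_{P_2}G(y,x_2)$; and for all $y_1,y_2\in Y$, $y_1\leq_{P_2}y_2$ implies $F(x,y_1)\geq_{P_1}F(x,y_2)$ and $G(y_1,x)\leq_{P_2}G(y_2,x)$. *)

theory Defs
  imports "HOL-Analysis.Analysis"
begin

text \<open>
  A partially ordered complete metric space is rendered as a type of sort
  \<open>{complete_space, order}\<close>. The two classes are independent: no relation between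
  the order and the metric (in particular no order topology) is implied.
\<close>

definition mixed_monotone ::
  "('a::order \<Rightarrow> 'b::order \<Rightarrow> 'a) \<Rightarrow> ('b \<Rightarrow> 'a \<Rightarrow> 'b) \<Rightarrow> bool" where
  "mixed_monotone F G \<longleftrightarrow>
    (\<forall>x y.
      (\<forall>x1 x2. x1 \<le> x2 \<longrightarrow> F x1 y \<le> F x2 y \<and> G y x1 \<ge> G y x2) \<and>
      (\<forall>y1 y2. y1 \<le> y2 \<longrightarrow> F x y1 \<ge> F x y2 \<and> G y1 x \<le> G y2 x))"

end

theory Submission
  imports Defs
begin

text \<open>
  Iterate \<open>(x, y) \<mapsto> (F x y, G y x)\<close> from the given starting point. Mixed monotonicity
  makes the first coordinates increase and the second ones decrease, so successive iterates are
  comparable in the sense required by the contraction conditions, and the larger of the two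
  coordinate steps shrinks by the factor \<open>max (k + l) (m + n) < 1\<close>. Both sequences therefore
  converge; the order properties of the limits make each iterate comparable with the limit, and
  the contraction conditions then replace continuity of \<open>F\<close> and \<open>G\<close> in passing to the limit.
\<close>

lemma dist_le_sum_dist_Suc:
  fixes s :: "nat \<Rightarrow> 'a::metric_space"
  assumes "p \<le> q"
  shows "dist (s p) (s q) \<le> (\<Sum>j = p..<q. dist (s j) (s (Suc j)))"
  using assms
proof (induction q rule: dec_induct)
  case base
  show ?case by simp
next
  case (step q)
  have "dist (s p) (s (Suc q)) \<le> dist (s p) (s q) + dist (s q) (s (Suc q))"
    by (rule dist_triangle)
  with step show ?case by simp
qed

text \<open>By the iterated triangle inequality, the distance of two terms is at most a block of the
  series of steps, and the Cauchy criterion makes late blocks small.\<close>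

lemma Cauchy_if_summable_dist_Suc:
  fixes s :: "nat \<Rightarrow> 'a::metric_space"
  assumes "summable (\<lambda>j. dist (s j) (s (Suc j)))"
  shows "Cauchy s"
proof (rule metric_CauchyI)
  fix e :: real
  assume "e > 0"
  then obtain N where N: "norm (\<Sum>j = p..<q. dist (s j) (s (Suc j))) < e" if "p \<ge> N" for p q
    using assms unfolding summable_Cauchy by blast
  have less: "dist (s p) (s q) < e" if "p \<ge> N" "p \<le> q" for p q
    using dist_le_sum_dist_Suc[OF that(2), of s] N[OF that(1), of q] by simp
  have "dist (s p) (s q) < e" if "p \<ge> N" "q \<ge> N" for p q
    using less[of p q] less[of q p] that by (cases "p \<le> q") (simp_all add: dist_commute)
  then show "\<exists>M. \<forall>p\<ge>M. \<forall>q\<ge>M. dist (s p) (s q) < e"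
    by blast
qed

lemma convergent_if_dist_Suc_geometric:
  fixes s :: "nat \<Rightarrow> 'a::complete_space"
  assumes "0 \<le> r" "r < 1" and "\<And>j. dist (s j) (s (Suc j)) \<le> C * r ^ j"
  shows "convergent s"
proof (rule Cauchy_convergent, rule Cauchy_if_summable_dist_Suc)
  have "summable (\<lambda>j. C * r ^ j)"
    using assms(1,2) by (intro summable_mult summable_geometric) simp
  then show "summable (\<lambda>j. dist (s j) (s (Suc j)))"
    by (rule summable_comparison_test') (simp add: assms(3))
qed

text \<open>Serves both contraction estimates: \<open>a\<close>, \<open>b\<close> become
  \<open>k\<close>, \<open>l\<close> or \<open>m\<close>, \<open>n\<close>, and \<open>D\<close> is
  a common bound on the steps of the two coordinates.\<close>

lemma linear_le_max_mult:
  fixes a b c d r D :: real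
  assumes "0 \<le> a" "0 \<le> b" "a + b \<le> r" "c \<le> D" "d \<le> D" "0 \<le> D"
  shows "a * c + b * d \<le> r * D"
proof -
  have "a * c + b * d \<le> a * D + b * D"
    using assms by (intro add_mono mult_left_mono)
  also have "\<dots> \<le> r * D"
    using assms by (metis distrib_right mult_right_mono)
  finally show ?thesis .
qed

theorem theorem2p3:
  fixes F :: "'a::{complete_space,order} \<Rightarrow> 'b::{complete_space,order} \<Rightarrow> 'a"
    and G :: "'b \<Rightarrow> 'a \<Rightarrow> 'b"
    and k l m n :: real
  assumes mixed: "mixed_monotone F G"
    and X_prop: "\<And>(s :: nat \<Rightarrow> 'a) x. incseq s \<Longrightarrow> s \<longlonglongrightarrow> x \<Longrightarrow> (\<forall>j. s j \<le> x)"
    and Y_prop: "\<And>(t :: nat \<Rightarrow> 'b) y. decseq t \<Longrightarrow> t \<longlonglongrightarrow> y \<Longrightarrow> (\<forall>j. y \<le> t j)"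
    and klmn: "k \<in> {0..<1}" "l \<in> {0..<1}" "m \<in> {0..<1}" "n \<in> {0..<1}"
    and "k + l < 1" and "m + n < 1"
    and F_contr: "\<And>x u y v. x \<ge> u \<Longrightarrow> y \<le> v \<Longrightarrow>
           dist (F x y) (F u v) \<le> k * dist x u + l * dist y v"
    and G_contr: "\<And>x u y v. x \<le> u \<Longrightarrow> y \<ge> v \<Longrightarrow>
           dist (G y x) (G v u) \<le> m * dist y v + n * dist x u"
    and start: "\<exists>x0 y0. x0 \<le> F x0 y0 \<and> y0 \<ge> G y0 x0"
  shows "\<exists>x y. x = F x y \<and> y = G y x"
proof -
  obtain x0 y0 where x0: "x0 \<le> F x0 y0" and y0: "G y0 x0 \<le> y0"
    using start by blast
  \<comment> \<open>The pair is iterated as a whole, since each coordinate of the next iterate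
    depends on both current ones.\<close>
  define z where "z j = ((\<lambda>(x, y). (F x y, G y x)) ^^ j) (x0, y0)" for j
  define s where "s j = fst (z j)" for j
  define t where "t j = snd (z j)" for j
  have s_0: "s 0 = x0" and t_0: "t 0 = y0"
    by (simp_all add: s_def t_def z_def)
  have s_Suc: "s (Suc j) = F (s j) (t j)" and t_Suc: "t (Suc j) = G (t j) (s j)" for j
    by (simp_all add: s_def t_def z_def case_prod_unfold)
  \<comment> \<open>Change one argument at a time and chain, for instance \<open>F x y\<close> \<le>
    \<open>F x' y\<close> \<le> \<open>F x' y'\<close>.\<close>
  have F_mono: "F x y \<le> F x' y'" and G_mono: "G y' x' \<le> G y x" if "x \<le> x'" "y' \<le> y" for x x' y y'
    using mixed that unfolding mixed_monotone_def by (meson order_trans)+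
  have step: "s j \<le> s (Suc j) \<and> t (Suc j) \<le> t j" for j
  proof (induction j)
    case 0
    show ?case using x0 y0 by (simp add: s_Suc t_Suc s_0 t_0)
  next
    case (Suc j)
    then show ?case
      using F_mono G_mono by (metis s_Suc t_Suc)
  qed
  then have inc: "incseq s" and dec: "decseq t"
    by (auto intro: incseq_SucI decseq_SucI)
  define r where "r = max (k + l) (m + n)"
  have r: "0 \<le> r" "r < 1"
    using klmn \<open>k + l < 1\<close> \<open>m + n < 1\<close> by (auto simp: r_def)
  define C where "C = max (dist (s 0) (s 1)) (dist (t 0) (t 1))"
  have C: "0 \<le> C"
    by (simp add: C_def le_max_iff_disj)
  \<comment> \<open>Both bounds go through one induction, because each contraction estimate mixes
    the steps of both sequences; taking \<open>C\<close> as the larger first step settles both base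
    cases.\<close>
  have geometric: "dist (s j) (s (Suc j)) \<le> C * r ^ j \<and> dist (t j) (t (Suc j)) \<le> C * r ^ j" for j
  proof (induction j)
    case 0
    show ?case by (simp add: C_def)
  next
    case (Suc j)
    have nonneg: "0 \<le> C * r ^ j" using C r by simp
    have "dist (s (Suc j)) (s (Suc (Suc j)))
        \<le> k * dist (s j) (s (Suc j)) + l * dist (t j) (t (Suc j))"
      \<comment> \<open>\<open>F_contr\<close> needs the larger first coordinate and the smaller
        second one in its first point, so the later iterate stands first there and
        \<open>dist_commute\<close> turns the distances around. In \<open>G_contr\<close> the
        earlier iterate stands first.\<close>
      using F_contr[of "s j" "s (Suc j)" "t (Suc j)" "t j"] step[of j]
      by (simp add: s_Suc[of j] s_Suc[of "Suc j"] dist_commute)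
    also have "\<dots> \<le> r * (C * r ^ j)"
      using klmn Suc nonneg by (intro linear_le_max_mult) (auto simp: r_def)
    finally have 1: "dist (s (Suc j)) (s (Suc (Suc j))) \<le> C * r ^ Suc j"
      by (simp add: mult_ac)
    have "dist (t (Suc j)) (t (Suc (Suc j)))
        \<le> m * dist (t j) (t (Suc j)) + n * dist (s j) (s (Suc j))"
      using G_contr[of "s j" "s (Suc j)" "t (Suc j)" "t j"] step[of j]
      by (simp add: t_Suc[of j] t_Suc[of "Suc j"])
    also have "\<dots> \<le> r * (C * r ^ j)"
      using klmn Suc nonneg by (intro linear_le_max_mult) (auto simp: r_def)
    finally have 2: "dist (t (Suc j)) (t (Suc (Suc j))) \<le> C * r ^ Suc j"
      by (simp add: mult_ac)
    from 1 2 show ?case ..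
  qed
  obtain x where x: "s \<longlonglongrightarrow> x"
    using convergent_if_dist_Suc_geometric[OF r] geometric unfolding convergent_def by meson
  obtain y where y: "t \<longlonglongrightarrow> y"
    using convergent_if_dist_Suc_geometric[OF r] geometric unfolding convergent_def by meson
  have s_le: "s j \<le> x" and t_ge: "y \<le> t j" for j
    using X_prop[OF inc x] Y_prop[OF dec y] by blast+
  have "(\<lambda>j. s (Suc j)) \<longlonglongrightarrow> F x y"
  proof (rule metric_tendsto_imp_tendsto)
    show "(\<lambda>j. k * dist (s j) x + l * dist (t j) y) \<longlonglongrightarrow> 0"
      by (rule tendsto_eq_intros x y | simp)+
    \<comment> \<open>The comparison rule wants the real bound as its distance to 0, that is, its
      absolute value, which is no smaller than the bound itself.\<close>
    show "\<forall>\<^sub>F j in sequentially.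
        dist (s (Suc j)) (F x y) \<le> dist (k * dist (s j) x + l * dist (t j) y) 0"
    proof (intro always_eventually allI)
      fix j
      have "dist (s (Suc j)) (F x y) \<le> k * dist (s j) x + l * dist (t j) y"
        using F_contr[OF s_le t_ge, of j j] by (simp add: s_Suc dist_commute)
      then show "dist (s (Suc j)) (F x y) \<le> dist (k * dist (s j) x + l * dist (t j) y) 0"
        by simp
    qed
  qed
  moreover have "(\<lambda>j. t (Suc j)) \<longlonglongrightarrow> G y x"
  proof (rule metric_tendsto_imp_tendsto)
    show "(\<lambda>j. m * dist (t j) y + n * dist (s j) x) \<longlonglongrightarrow> 0"
      by (rule tendsto_eq_intros x y | simp)+
    show "\<forall>\<^sub>F j in sequentially.
        dist (t (Suc j)) (G y x) \<le> dist (m * dist (t j) y + n * dist (s j) x) 0"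
    proof (intro always_eventually allI)
      fix j
      have "dist (t (Suc j)) (G y x) \<le> m * dist (t j) y + n * dist (s j) x"
        using G_contr[OF s_le t_ge, of j j] by (simp add: t_Suc)
      then show "dist (t (Suc j)) (G y x) \<le> dist (m * dist (t j) y + n * dist (s j) x) 0"
        by simp
    qed
  qed
  \<comment> \<open>The shifted sequences also converge to \<open>x\<close> and \<open>y\<close>, so
    uniqueness of limits gives both equations.\<close>
  ultimately have "x = F x y" "y = G y x"
    using LIMSEQ_unique LIMSEQ_Suc x y by blast+
  then show ?thesis by blast
qed

end
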